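(* For every $0<\delta<\tfrac12$ there exists a constant $K(\delta)>0$, depending only on $\delta$, such that for every integer $n\ge2$ and every continuous time Markov chain $X$ on $I=\{1,\ldots,n\}$ which is irreducible and reversible with respect to the uniform distribution on $I$, $$\int_0^\infty \mathbf{1}_{\{t\geq0:\;\frac{1}{n^2}\sum_{(a,b)\in I^2}\|P^a_t-P^b_t\|^2_2\notin A_L^\delta\}}\,\frac{1}{t}\,\mathrm{d}t \leq K(\delta)\,n .$$
   Context: For $a\in I$ and $t\ge0$, $P^a_t$ denotes the distribution of $X(t)$ when $X(0)=a$, and $\|\pi\|_2^2=\sum_{i\in I}\pi(i)^2$. Let $A_L=\{0,\frac2n,\frac4n,\ldots,\frac{2(n-1)}{n}\}$, and let $A_L^\delta$ be the $\frac{2\delta}{n}$-neighborhood of $A_L$ in $[0,\frac{2(n-1)}{n}]$, i.e. the set of points of $[0,\frac{2(n-1)}{n}]$ at distance at most $\frac{2\delta}{n}$ from $A_L$. *)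

theory Defs
  imports "HOL-Probability.Probability"
begin

text \<open>
  Right-continuous paths with values in the finite set \<open>I\<close>, with the sigma-algebra generated by
  the evaluation maps. Time is \<open>{0..}\<close>; paths are \<open>undefined\<close> at negative times.
\<close>

definition path_space :: "nat set \<Rightarrow> (real \<Rightarrow> nat) measure" where
  "path_space I = restrict_space (PiM {0..} (\<lambda>_. count_space I))
     {\<omega>. \<forall>t\<ge>0. (\<omega> \<longlongrightarrow> \<omega> t) (at_right t)}"

text \<open>
  \<open>P a\<close> is the law of the whole path of the chain started at \<open>a\<close>, so that the time-\<open>t\<close> value
  \<open>X(t)\<close> is the evaluation map \<open>\<lambda>\<omega>. \<omega> t\<close> and \<open>distr_at P a t b\<close> is the probability of
  \<open>X(t) = b\<close> given \<open>X(0) = a\<close>.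
\<close>

definition distr_at :: "(nat \<Rightarrow> (real \<Rightarrow> nat) measure) \<Rightarrow> nat \<Rightarrow> real \<Rightarrow> nat \<Rightarrow> real" where
  "distr_at P a t b = \<P>(\<omega> in P a. \<omega> t = b)"

definition markov_chain :: "nat set \<Rightarrow> (nat \<Rightarrow> (real \<Rightarrow> nat) measure) \<Rightarrow> bool" where
  "markov_chain I P \<longleftrightarrow>
     (\<forall>a\<in>I. prob_space (P a) \<and> sets (P a) = sets (path_space I) \<and> (AE \<omega> in P a. \<omega> 0 = a)) \<and>
     (\<forall>a\<in>I. \<forall>(k::nat) (s::nat \<Rightarrow> real) (i::nat \<Rightarrow> nat) (u::real). \<forall>j\<in>I.
        0 \<le> s 0 \<and> (\<forall>l<k. s l < s (Suc l)) \<and> (\<forall>l\<le>k. i l \<in> I) \<and> 0 \<le> u \<and>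
        \<P>(\<omega> in P a. \<forall>l\<le>k. \<omega> (s l) = i l) > 0 \<longrightarrow>
        \<P>(\<omega> in P a. \<omega> (s k + u) = j \<bar> \<forall>l\<le>k. \<omega> (s l) = i l) = distr_at P (i k) u j)"

definition irreducible_chain :: "nat set \<Rightarrow> (nat \<Rightarrow> (real \<Rightarrow> nat) measure) \<Rightarrow> bool" where
  "irreducible_chain I P \<longleftrightarrow> (\<forall>a\<in>I. \<forall>b\<in>I. \<exists>t\<ge>0. distr_at P a t b > 0)"

definition reversible_wrt :: "nat set \<Rightarrow> nat pmf \<Rightarrow> (nat \<Rightarrow> (real \<Rightarrow> nat) measure) \<Rightarrow> bool" where
  "reversible_wrt I \<pi> P \<longleftrightarrow>
     (\<forall>t\<ge>0. \<forall>a\<in>I. \<forall>b\<in>I. pmf \<pi> a * distr_at P a t b = pmf \<pi> b * distr_at P b t a)"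

definition l2_norm_sq :: "nat set \<Rightarrow> (nat \<Rightarrow> real) \<Rightarrow> real" where
  "l2_norm_sq I v = (\<Sum>i\<in>I. (v i)\<^sup>2)"

definition mean_l2_dist :: "nat \<Rightarrow> (nat \<Rightarrow> (real \<Rightarrow> nat) measure) \<Rightarrow> real \<Rightarrow> real" where
  "mean_l2_dist n P t = 1 / (real n)\<^sup>2 *
     (\<Sum>(a, b)\<in>{1..n} \<times> {1..n}. l2_norm_sq {1..n} (\<lambda>i. distr_at P a t i - distr_at P b t i))"

definition A_L :: "nat \<Rightarrow> real set" where
  "A_L n = {2 * real k / real n | k. k < n}"

definition A_L_nbhd :: "nat \<Rightarrow> real \<Rightarrow> real set" where
  "A_L_nbhd n \<delta> =
     {x \<in> {0..2 * (real n - 1) / real n}. \<exists>y\<in>A_L n. dist x y \<le> 2 * \<delta> / real n}"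

end

theory Submission
  imports Defs "Jordan_Normal_Form.Schur_Decomposition"
begin

text \<open>
  Reversibility with respect to the uniform distribution makes the transition matrices symmetric and
  doubly stochastic, so expanding the squares turns the mean distance at time \<open>t\<close> into
  \<open>2 / n * (tr (P (2 * t)) - 1)\<close>, that is, \<open>2 / n * F t\<close> with \<open>F t = (\<Sum>k=2..n. exp (- 2 * \<lambda>\<^sub>k * t))\<close>
  for the eigenvalues \<open>0 = \<lambda>\<^sub>1 \<le> \<dots> \<le> \<lambda>\<^sub>n\<close> of minus the generator. The distance of \<open>F t\<close> to the integers
  is at most the sum of \<open>min (exp (- 2 * \<lambda>\<^sub>k * t)) (1 - exp (- 2 * \<lambda>\<^sub>k * t))\<close>. The integral of each such
  term against \<open>dt / t\<close> is at most 3 because that measure is invariant under scaling, and Markov's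
  inequality gives the bound with \<open>K = 3 / \<delta>\<close>.
\<close>

unbundle no vec_syntax

subsection \<open>Traces and characteristic polynomials of powers\<close>

definition mat_trace :: "'a::comm_monoid_add mat \<Rightarrow> 'a" where
  "mat_trace A = (\<Sum>i<dim_row A. A $$ (i, i))"

lemma mat_trace_mult_commute:
  fixes A B :: "'a::comm_semiring_0 mat"
  assumes "A \<in> carrier_mat n m" "B \<in> carrier_mat m n"
  shows "mat_trace (A * B) = mat_trace (B * A)"
proof -
  have "mat_trace (A * B) = (\<Sum>i<n. \<Sum>j<m. A $$ (i, j) * B $$ (j, i))"
    using assms by (auto simp: mat_trace_def scalar_prod_def atLeast0LessThan intro!: sum.cong)
  also have "\<dots> = (\<Sum>j<m. \<Sum>i<n. B $$ (j, i) * A $$ (i, j))"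
    by (subst sum.swap) (simp add: mult.commute)
  also have "\<dots> = mat_trace (B * A)"
    using assms by (auto simp: mat_trace_def scalar_prod_def atLeast0LessThan intro!: sum.cong)
  finally show ?thesis .
qed

lemma mat_trace_conv_diag_mat: "mat_trace A = sum_list (diag_mat A)"
  by (simp add: mat_trace_def diag_mat_def interv_sum_list_conv_sum_set_nat atLeast0LessThan)

lemma similar_mat_trace:
  fixes A B :: "'a::comm_ring_1 mat"
  assumes "similar_mat_wit A B P Q"
  shows "mat_trace A = mat_trace B"
proof -
  define n where "n = dim_row A"
  from similar_mat_witD[OF n_def assms]
  have *: "Q * P = 1\<^sub>m n" "A = P * B * Q" "B \<in> carrier_mat n n" "P \<in> carrier_mat n n" "Q \<in> carrier_mat n n"
    by auto
  have "mat_trace A = mat_trace (Q * (P * B))"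
    using * mat_trace_mult_commute[of "P * B" n n Q] by simp
  also have "Q * (P * B) = B"
    using assoc_mult_mat[OF *(5,4,3)] *(1) left_mult_one_mat[OF *(3)] by simp
  finally show ?thesis .
qed

text \<open>The product \<open>A $$ (i, k) * B $$ (k, j)\<close> vanishes unless
  \<open>i \<le> k\<close> and \<open>k \<le> j\<close>: no \<open>k\<close> survives below the
  diagonal, and only \<open>k = i\<close> on it.\<close>

lemma upper_triangular_mult_diag:
  fixes A B :: "'a::comm_ring_1 mat"
  assumes A: "A \<in> carrier_mat n n" and B: "B \<in> carrier_mat n n"
    and "upper_triangular A" "upper_triangular B"
  shows "upper_triangular (A * B)"
    and "i < n \<Longrightarrow> (A * B) $$ (i, i) = A $$ (i, i) * B $$ (i, i)"
proof -
  have z: "A $$ (i, k) * B $$ (k, j) = 0" if "i < n" "k < n" "j < n" "k < i \<or> j < k" for i j k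
    using that assms by (auto simp: upper_triangular_def)
  show "upper_triangular (A * B)"
    unfolding upper_triangular_def
  proof (intro allI impI)
    fix i j assume "i < dim_row (A * B)" "j < i"
    then show "(A * B) $$ (i, j) = 0"
      using A B by (auto simp: scalar_prod_def intro!: sum.neutral z)
  qed
  assume i: "i < n"
  have "(A * B) $$ (i, i) = (\<Sum>k = 0..<n. A $$ (i, k) * B $$ (k, i))"
    using A B i by (simp add: scalar_prod_def)
  also have "\<dots> = (\<Sum>k\<in>{i}. A $$ (i, k) * B $$ (k, i))"
    using i by (intro sum.mono_neutral_right) (auto intro!: z)
  finally show "(A * B) $$ (i, i) = A $$ (i, i) * B $$ (i, i)" by simp
qed

lemma upper_triangular_pow:
  fixes A :: "'a::comm_ring_1 mat"
  assumes A: "A \<in> carrier_mat n n" and ut: "upper_triangular A"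
  shows "upper_triangular (A ^\<^sub>m k)" "diag_mat (A ^\<^sub>m k) = map (\<lambda>x. x ^ k) (diag_mat A)"
proof -
  have "upper_triangular (A ^\<^sub>m k) \<and> (\<forall>i<n. (A ^\<^sub>m k) $$ (i, i) = (A $$ (i, i)) ^ k)"
  proof (induction k)
    case 0
    then show ?case using A by (auto simp: upper_triangular_def)
  next
    case (Suc k)
    then show ?case
      using upper_triangular_mult_diag[OF pow_carrier_mat[OF A] A _ ut] by (simp add: mult.commute)
  qed
  then show "upper_triangular (A ^\<^sub>m k)" "diag_mat (A ^\<^sub>m k) = map (\<lambda>x. x ^ k) (diag_mat A)"
    using A by (auto simp: diag_mat_def)
qed

text \<open>A Schur decomposition of \<open>A\<close> triangularizes all its powers with the same
  \<open>P\<close> and \<open>Q\<close>, so the diagonal of \<open>B ^\<^sub>m k\<close> displays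
  the spectrum of \<open>A ^\<^sub>m k\<close> with multiplicity. Diagonalizability does not
  enter.\<close>

lemma
  fixes A :: "'a::conjugatable_ordered_field mat"
  assumes A: "A \<in> carrier_mat n n" and es: "char_poly A = (\<Prod>a\<leftarrow>es. [:- a, 1:])"
  shows char_poly_pow_eq: "char_poly (A ^\<^sub>m k) = (\<Prod>a\<leftarrow>map (\<lambda>x. x ^ k) es. [:- a, 1:])"
    and mat_trace_pow_eq: "mat_trace (A ^\<^sub>m k) = (\<Sum>a\<leftarrow>es. a ^ k)"
proof -
  obtain B P Q where "schur_decomposition A es = (B, P, Q)"
    by (metis prod_cases3)
  from schur_decomposition[OF A es this]
  have w: "similar_mat_wit A B P Q" and ut: "upper_triangular B" and d: "diag_mat B = es" by auto
  have B: "B \<in> carrier_mat n n" using similar_mat_witD2[OF A w] by auto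
  have wk: "similar_mat_wit (A ^\<^sub>m k) (B ^\<^sub>m k) P Q" by (rule similar_mat_wit_pow[OF w])
  have "char_poly (A ^\<^sub>m k) = char_poly (B ^\<^sub>m k)"
    by (rule char_poly_similar) (use wk in \<open>auto simp: similar_mat_def\<close>)
  also have "\<dots> = (\<Prod>a\<leftarrow>diag_mat (B ^\<^sub>m k). [:- a, 1:])"
    by (rule char_poly_upper_triangular[OF pow_carrier_mat[OF B] upper_triangular_pow(1)[OF B ut]])
  finally show "char_poly (A ^\<^sub>m k) = (\<Prod>a\<leftarrow>map (\<lambda>x. x ^ k) es. [:- a, 1:])"
    by (simp only: upper_triangular_pow(2)[OF B ut] d)
  have "mat_trace (A ^\<^sub>m k) = mat_trace (B ^\<^sub>m k)"
    by (rule similar_mat_trace[OF wk])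
  then show "mat_trace (A ^\<^sub>m k) = (\<Sum>a\<leftarrow>es. a ^ k)"
    unfolding mat_trace_conv_diag_mat[of "B ^\<^sub>m k"] upper_triangular_pow(2)[OF B ut] d .
qed

section \<open>Multisets of eigenvalues and real spectra of symmetric matrices\<close>

lemma prod_linear_factors_nonzero: "(\<Prod>a\<leftarrow>xs. [:- a, 1:]) \<noteq> (0 :: 'a::idom poly)"
  by (induction xs) (simp_all del: mult_pCons_left)

lemma proots_linear_factors:
  fixes xs :: "'a::idom list"
  shows "proots (\<Prod>a\<leftarrow>xs. [:- a, 1:]) = mset xs"
  by (induction xs) (simp_all only: list.map prod_list.Cons prod_list.Nil proots_1 proots_mult mult_eq_0_iff
      pCons_eq_0_iff one_neq_zero prod_linear_factors_nonzero simp_thms proots_linear_factor minus_minus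
      mset.simps add_mset_add_single[symmetric] add.commute[of "{#_#}"])

lemma mset_linear_factors_unique:
  fixes xs ys :: "'a::idom list"
  assumes "(\<Prod>a\<leftarrow>xs. [:- a, 1:]) = (\<Prod>a\<leftarrow>ys. [:- a, 1:])"
  shows "mset xs = mset ys"
  using assms proots_linear_factors by metis

text \<open>The Hermitian form of the matrix at \<open>v\<close> equals \<open>e\<close> times the
  squared norm of \<open>v\<close>, and by symmetry it is its own conjugate; as the norm is nonzero,
  so is \<open>e\<close>'s conjugate equal to \<open>e\<close>.\<close>

lemma eigenvalue_symmetric_real:
  fixes A :: "real mat"
  assumes A: "A \<in> carrier_mat n n" and sym: "\<And>i j. i < n \<Longrightarrow> j < n \<Longrightarrow> A $$ (i, j) = A $$ (j, i)"
    and ev: "eigenvalue (map_mat complex_of_real A) e"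
  shows "e \<in> \<real>"
proof -
  obtain v where v: "v \<in> carrier_vec n" "v \<noteq> 0\<^sub>v n" "map_mat complex_of_real A *\<^sub>v v = e \<cdot>\<^sub>v v"
    using ev A by (auto simp: eigenvalue_def eigenvector_def)
  have e: "(\<Sum>j<n. of_real (A $$ (i, j)) * v $ j) = e * v $ i" if "i < n" for i
  proof -
    have "(map_mat complex_of_real A *\<^sub>v v) $ i = (e \<cdot>\<^sub>v v) $ i" using v by simp
    then show ?thesis using that A v(1) by (simp add: scalar_prod_def atLeast0LessThan)
  qed
  define N where "N = (\<Sum>i<n. (cmod (v $ i))\<^sup>2)"
  define S where "S = (\<Sum>i<n. \<Sum>j<n. of_real (A $$ (i, j)) * v $ j * cnj (v $ i))"
  have "S = (\<Sum>i<n. (\<Sum>j<n. of_real (A $$ (i, j)) * v $ j) * cnj (v $ i))"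
    by (simp add: S_def sum_distrib_right)
  also have "\<dots> = (\<Sum>i<n. e * (v $ i * cnj (v $ i)))"
    by (intro sum.cong) (auto simp: e mult.assoc)
  also have "\<dots> = e * of_real N"
    by (simp add: N_def complex_norm_square[symmetric] sum_distrib_left)
  finally have S: "S = e * of_real N" .
  have "cnj S = (\<Sum>i<n. \<Sum>j<n. of_real (A $$ (i, j)) * cnj (v $ j) * v $ i)"
    by (simp add: S_def)
  also have "\<dots> = (\<Sum>j<n. \<Sum>i<n. of_real (A $$ (i, j)) * cnj (v $ j) * v $ i)"
    by (rule sum.swap)
  also have "\<dots> = S" unfolding S_def
    by (intro sum.cong) (auto simp: sym mult_ac)
  finally have "cnj S = S" .
  moreover have "N \<noteq> 0"
  proof
    assume "N = 0"
    then have "\<forall>i<n. v $ i = 0"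
      unfolding N_def by (subst (asm) sum_nonneg_eq_0_iff) auto
    then show False using v by (auto simp: vec_eq_iff)
  qed
  ultimately have "cnj e = e" using S by simp
  then show ?thesis by (simp add: Reals_cnj_iff)
qed

text \<open>The characteristic polynomial splits over the complex numbers with real roots;
  injectivity of the embedding of real polynomials brings the factorization back.\<close>

lemma char_poly_symmetric_real:
  fixes A :: "real mat"
  assumes A: "A \<in> carrier_mat n n" and sym: "\<And>i j. i < n \<Longrightarrow> j < n \<Longrightarrow> A $$ (i, j) = A $$ (j, i)"
  obtains es where "char_poly A = (\<Prod>a\<leftarrow>es. [:- a, 1:])" "length es = n"
proof -
  let ?C = "map_mat complex_of_real A"
  have C: "?C \<in> carrier_mat n n" using A by simp
  obtain cs where cs: "char_poly ?C = (\<Prod>a\<leftarrow>cs. [:- a, 1:])" "length cs = n"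
    using char_poly_factorized[OF C] by blast
  have "c \<in> \<real>" if "c \<in> set cs" for c
  proof (rule eigenvalue_symmetric_real[OF A sym])
    show "eigenvalue ?C c"
      unfolding eigenvalue_root_char_poly[OF C] cs(1) using that by (rule linear_poly_root)
  qed
  then have real: "map (complex_of_real \<circ> Re) cs = cs"
    by (intro map_idI) (auto simp: of_real_Re)
  interpret hom: map_poly_inj_idom_hom complex_of_real ..
  have "map_poly complex_of_real (char_poly A) = char_poly ?C"
    by (rule of_real_hom.char_poly_hom[OF A, symmetric])
  also have "\<dots> = (\<Prod>a\<leftarrow>map Re cs. [:- complex_of_real a, 1:])"
    using cs(1) real by (metis (no_types, lifting) map_map comp_def map_eq_conv)
  also have "\<dots> = map_poly complex_of_real (\<Prod>a\<leftarrow>map Re cs. [:- a, 1:])"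
    by (simp add: hom.hom_prod_list o_def)
  finally have "char_poly A = (\<Prod>a\<leftarrow>map Re cs. [:- a, 1:])"
    by (rule hom.injectivity)
  with cs(2) show thesis by (intro that[of "map Re cs"]) auto
qed

subsection \<open>The trace of a symmetric Markov semigroup\<close>

text \<open>At level \<open>m\<close> the dyadic neighbours of \<open>t\<close> satisfy
  \<open>l m \<le> t \<le> u m\<close>, so monotonicity traps \<open>G t\<close> between
  \<open>H (u m)\<close> and \<open>H (l m)\<close>, and both tend to \<open>H t\<close>. This
  carries the trace formula from dyadic to all positive times, with monotonicity in place of
  continuity of the trace.\<close>

lemma antimono_eq_if_eq_on_dyadics:
  fixes G H :: "real \<Rightarrow> real"
  assumes anti: "\<And>s t. 0 < s \<Longrightarrow> s \<le> t \<Longrightarrow> G t \<le> G s"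
    and cont: "isCont H t" and t: "0 < t"
    and eq: "\<And>m k. 0 < k \<Longrightarrow> G (real k / 2 ^ m) = H (real k / 2 ^ m)"
  shows "G t = H t"
proof -
  define k where "k m = nat \<lfloor>t * 2 ^ m\<rfloor>" for m :: nat
  define l where "l m = real (k m) / 2 ^ m" for m
  define u where "u m = real (Suc (k m)) / 2 ^ m" for m
  have k: "real (k m) \<le> t * 2 ^ m" "t * 2 ^ m < real (k m) + 1" for m
  proof -
    have "real (k m) = of_int \<lfloor>t * 2 ^ m\<rfloor>"
      using t by (simp add: k_def)
    then show "real (k m) \<le> t * 2 ^ m" "t * 2 ^ m < real (k m) + 1" by linarith+
  qed
  have "l m \<le> t" "t \<le> u m" for m
    using k[of m] by (simp_all add: l_def u_def pos_le_divide_eq pos_divide_le_eq)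
  moreover have "u m = l m + 1 / 2 ^ m" for m
    by (simp add: l_def u_def add_divide_distrib)
  ultimately have l: "l m \<le> t" "t - 1 / 2 ^ m \<le> l m" and u: "t \<le> u m" "u m \<le> t + 1 / 2 ^ m" for m
    by (smt (verit))+
  have lim0: "(\<lambda>m. 1 / 2 ^ m :: real) \<longlonglongrightarrow> 0"
    using LIMSEQ_inverse_realpow_zero[of 2] by (simp add: inverse_eq_divide)
  have lim: "(\<lambda>m. t - 1 / 2 ^ m) \<longlonglongrightarrow> t" "(\<lambda>m. t + 1 / 2 ^ m) \<longlonglongrightarrow> t"
    using tendsto_diff[OF tendsto_const lim0, of t] tendsto_add[OF tendsto_const lim0, of t] by simp_all
  have liml: "l \<longlonglongrightarrow> t"
    by (rule tendsto_sandwich[OF _ _ lim(1) tendsto_const]) (simp_all add: l)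
  have limu: "u \<longlonglongrightarrow> t"
    by (rule tendsto_sandwich[OF _ _ tendsto_const lim(2)]) (simp_all add: u)
  \<comment> \<open>For small \<open>m\<close> the lower neighbour may be 0, where \<open>G\<close>
    and \<open>H\<close> are not known to agree.\<close>
  have pos: "\<forall>\<^sub>F m in sequentially. 0 < l m"
    using liml t by (rule order_tendstoD(1))
  have "(\<lambda>m. H (l m)) \<longlonglongrightarrow> H t" "(\<lambda>m. H (u m)) \<longlonglongrightarrow> H t"
    using isCont_tendsto_compose[OF cont] liml limu by auto
  moreover have "\<forall>\<^sub>F m in sequentially. G t \<le> H (l m)"
    using pos
  proof eventually_elim
    case (elim m)
    then have "0 < k m" by (simp add: l_def zero_less_divide_iff)
    then show ?case using anti[OF elim l(1)] eq[of "k m" m] by (simp add: l_def)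
  qed
  moreover have "H (u m) \<le> G t" for m
    using anti[OF t u(1)[of m]] eq[of "Suc (k m)" m] by (simp add: u_def)
  ultimately show ?thesis
    by (intro antisym tendsto_lowerbound[of "\<lambda>m. H (l m)" _ sequentially]
        tendsto_upperbound[of "\<lambda>m. H (u m)" _ sequentially]) auto
qed

text \<open>The transition matrices seen purely algebraically: neither continuity in
  \<open>t\<close> nor \<open>p 0 = 1\<^sub>m n\<close> is among the axioms. Hence the restriction
  to \<open>0 < k\<close> in \<open>power\<close> and to \<open>0 < t\<close> in
  \<open>trace_eq_sum_powr\<close>.\<close>

locale symmetric_markov_semigroup =
  fixes n :: nat and p :: "real \<Rightarrow> real mat"
  assumes carrier: "0 \<le> t \<Longrightarrow> p t \<in> carrier_mat n n"
    and sym: "0 \<le> t \<Longrightarrow> i < n \<Longrightarrow> j < n \<Longrightarrow> p t $$ (i, j) = p t $$ (j, i)"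
    and nonneg: "0 \<le> t \<Longrightarrow> i < n \<Longrightarrow> j < n \<Longrightarrow> 0 \<le> p t $$ (i, j)"
    and row_sum: "0 \<le> t \<Longrightarrow> i < n \<Longrightarrow> (\<Sum>j<n. p t $$ (i, j)) = 1"
    and semigroup: "0 \<le> s \<Longrightarrow> 0 \<le> t \<Longrightarrow> p (s + t) = p s * p t"
begin

lemma index_semigroup:
  assumes "0 \<le> s" "0 \<le> t" "i < n" "j < n"
  shows "p (s + t) $$ (i, j) = (\<Sum>k<n. p s $$ (i, k) * p t $$ (k, j))"
  using assms carrier[of s] carrier[of t]
  by (simp add: semigroup scalar_prod_def atLeast0LessThan)

lemma power:
  assumes "0 \<le> t" "0 < k"
  shows "p (real k * t) = p t ^\<^sub>m k"
  using assms(2)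
proof (induction k rule: nat_induct_non_zero)
  case 1
  then show ?case using carrier[OF assms(1)] by simp
next
  case (Suc k)
  have "p (real (Suc k) * t) = p (real k * t + t)" by (simp add: algebra_simps)
  also have "\<dots> = p (real k * t) * p t" using assms by (intro semigroup) auto
  finally show ?case by (simp add: Suc)
qed

text \<open>By symmetry the trace at time \<open>2 * t\<close> is the squared Hilbert-Schmidt norm
  at time \<open>t\<close>. This gives access to convexity arguments and is the link to the mean L2
  distance.\<close>

lemma trace_double:
  assumes "0 \<le> t"
  shows "mat_trace (p (t + t)) = (\<Sum>i<n. \<Sum>j<n. (p t $$ (i, j))\<^sup>2)"
proof -
  have "mat_trace (p (t + t)) = (\<Sum>i<n. p (t + t) $$ (i, i))"
    using carrier[of "t + t"] assms by (simp add: mat_trace_def)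
  also have "\<dots> = (\<Sum>i<n. \<Sum>j<n. p t $$ (i, j) * p t $$ (j, i))"
    using assms by (intro sum.cong refl) (simp only: lessThan_iff index_semigroup)
  also have "\<dots> = (\<Sum>i<n. \<Sum>j<n. (p t $$ (i, j))\<^sup>2)"
    by (intro sum.cong refl) (simp add: power2_eq_square sym[OF assms])
  finally show ?thesis .
qed

text \<open>Each entry of \<open>p (a + b)\<close> averages a row of \<open>p a\<close>, with a
  column of \<open>p b\<close> as weights. Jensen's inequality for squares and summation over the
  columns show that the Hilbert-Schmidt norm cannot grow.\<close>

lemma trace_antimono:
  assumes "0 \<le> s" "s \<le> t"
  shows "mat_trace (p t) \<le> mat_trace (p s)"
proof -
  \<comment> \<open>Halving the times makes the two traces squared norms at \<open>a\<close> and
    \<open>a + b\<close>.\<close>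
  define a where "a = s / 2"
  define b where "b = (t - s) / 2"
  have ab: "0 \<le> a" "0 \<le> b" using assms by (auto simp: a_def b_def)
  have st: "s = a + a" "t = (a + b) + (a + b)" by (auto simp: a_def b_def field_simps)
  have jensen: "(p (a + b) $$ (i, j))\<^sup>2 \<le> (\<Sum>k<n. (p a $$ (i, k))\<^sup>2 * p b $$ (k, j))"
    if ij: "i < n" "j < n" for i j
  proof -
    let ?w = "\<lambda>k. p b $$ (k, j)" and ?x = "\<lambda>k. p a $$ (i, k)"
    define m where "m = (\<Sum>k<n. ?x k * ?w k)"
    \<comment> \<open>Columns also sum to 1, by symmetry, so these are probability weights.\<close>
    have w: "(\<Sum>k<n. ?w k) = 1"
      using row_sum[OF ab(2) ij(2)] by (simp add: sym ab ij)
    \<comment> \<open>The variance about the weighted mean \<open>m\<close> is nonnegative;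
      expanding it gives Jensen's inequality.\<close>
    have "0 \<le> (\<Sum>k<n. (?x k - m)\<^sup>2 * ?w k)"
      using ab ij by (intro sum_nonneg mult_nonneg_nonneg nonneg) auto
    also have "\<dots> = (\<Sum>k<n. (?x k)\<^sup>2 * ?w k - 2 * m * (?x k * ?w k) + m\<^sup>2 * ?w k)"
      by (intro sum.cong) (auto simp: power2_eq_square algebra_simps)
    also have "\<dots> = (\<Sum>k<n. (?x k)\<^sup>2 * ?w k) - 2 * m * m + m\<^sup>2 * 1"
      by (simp add: sum.distrib sum_subtractf sum_distrib_left[symmetric] m_def[symmetric] w)
    finally have "m\<^sup>2 \<le> (\<Sum>k<n. (?x k)\<^sup>2 * ?w k)" by (simp add: power2_eq_square)
    then show ?thesis by (simp add: index_semigroup ab ij m_def)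
  qed
  have "mat_trace (p t) = (\<Sum>i<n. \<Sum>j<n. (p (a + b) $$ (i, j))\<^sup>2)"
    unfolding st(2) using ab by (intro trace_double) auto
  also have "\<dots> \<le> (\<Sum>i<n. \<Sum>j<n. \<Sum>k<n. (p a $$ (i, k))\<^sup>2 * p b $$ (k, j))"
    by (intro sum_mono) (auto intro: jensen)
  also have "\<dots> = (\<Sum>i<n. \<Sum>k<n. \<Sum>j<n. (p a $$ (i, k))\<^sup>2 * p b $$ (k, j))"
    by (intro sum.cong sum.swap) auto
  also have "\<dots> = (\<Sum>i<n. \<Sum>k<n. (p a $$ (i, k))\<^sup>2)"
    by (intro sum.cong) (auto simp: sum_distrib_left[symmetric] row_sum ab)
  also have "\<dots> = mat_trace (p s)"
    unfolding st(1) using ab by (intro trace_double[symmetric])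
  finally show ?thesis .
qed

lemma trace_le:
  assumes "0 \<le> t"
  shows "mat_trace (p t) \<le> real n"
proof -
  have "p t $$ (i, i) \<le> (\<Sum>j<n. p t $$ (i, j))" if "i < n" for i
    using that assms by (intro member_le_sum) (auto intro: nonneg)
  then have "(\<Sum>i<n. p t $$ (i, i)) \<le> (\<Sum>i<n. 1)"
    by (intro sum_mono) (auto simp: row_sum assms)
  then show ?thesis using carrier[OF assms] by (simp add: mat_trace_def)
qed

section \<open>Eigenvalues of the semigroup and the spectral formula for its trace\<close>

lemma char_poly_splits:
  assumes "0 \<le> t"
  obtains es where "char_poly (p t) = (\<Prod>a\<leftarrow>es. [:- a, 1:])" "length es = n"
  using char_poly_symmetric_real[OF carrier sym] assms by metis

text \<open>Since \<open>p t\<close> is the square of \<open>p (t / 2)\<close>, its eigenvalues are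
  squares of real numbers.\<close>

lemma char_poly_roots_nonneg:
  assumes t: "0 \<le> t" and es: "char_poly (p t) = (\<Prod>a\<leftarrow>es. [:- a, 1:])" and x: "x \<in> set es"
  shows "0 \<le> x"
proof -
  obtain fs where fs: "char_poly (p (t / 2)) = (\<Prod>a\<leftarrow>fs. [:- a, 1:])"
    using char_poly_splits[of "t / 2"] t by auto
  have "p t = p (t / 2) ^\<^sub>m 2"
    using power[of "t / 2" 2] t by simp
  then have "mset es = mset (map (\<lambda>x. x ^ 2) fs)"
    using char_poly_pow_eq[OF carrier fs, of 2] t es by (intro mset_linear_factors_unique) auto
  then have "set es = set (map (\<lambda>x. x ^ 2) fs)" by (rule mset_eq_setD)
  then show ?thesis using x by auto
qed

text \<open>
  All eigenvalues of \<open>p (1 / 2 ^ m)\<close> are nonnegative, so they are determined, with multiplicity, by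
  their powers, the eigenvalues of \<open>p 1\<close>; this makes simultaneous diagonalization unnecessary.
\<close>

lemma trace_dyadic:
  assumes es: "char_poly (p 1) = (\<Prod>a\<leftarrow>es. [:- a, 1:])" and k: "0 < k"
  shows "mat_trace (p (real k / 2 ^ m)) = (\<Sum>x\<leftarrow>es. x powr (real k / 2 ^ m))"
proof -
  let ?t = "1 / 2 ^ m :: real"
  obtain fs where fs: "char_poly (p ?t) = (\<Prod>a\<leftarrow>fs. [:- a, 1:])"
    using char_poly_splits[of ?t] by auto
  have "p 1 = p ?t ^\<^sub>m (2 ^ m)"
    using power[of ?t "2 ^ m"] by simp
  then have *: "mset es = mset (map (\<lambda>x. x ^ (2 ^ m)) fs)"
    using char_poly_pow_eq[OF carrier fs, of "2 ^ m"] es by (intro mset_linear_factors_unique) auto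
  have "mat_trace (p (real k / 2 ^ m)) = (\<Sum>y\<leftarrow>fs. y ^ k)"
    using power[of ?t k] k mat_trace_pow_eq[OF carrier fs, of k] by simp
  also have "\<dots> = (\<Sum>y\<leftarrow>fs. (y ^ (2 ^ m)) powr (real k / 2 ^ m))"
  proof (intro arg_cong[of _ _ sum_list] map_cong refl)
    fix y assume "y \<in> set fs"
    then have "0 \<le> y" using char_poly_roots_nonneg[OF _ fs] by simp
    then show "y ^ k = (y ^ (2 ^ m)) powr (real k / 2 ^ m)"
      \<comment> \<open>For \<open>y = 0\<close> both sides are 0: the right by the convention for
        \<open>powr\<close>, the left because \<open>0 < k\<close>.\<close>
      using k by (cases "y = 0") (simp_all add: zero_power powr_realpow[symmetric] powr_powr)
  qed
  also have "\<dots> = (\<Sum>x\<in>#mset (map (\<lambda>x. x ^ (2 ^ m)) fs). x powr (real k / 2 ^ m))"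
    by (simp add: sum_mset_sum_list[symmetric] multiset.map_comp o_def)
  also have "\<dots> = (\<Sum>x\<leftarrow>es. x powr (real k / 2 ^ m))"
    unfolding *[symmetric] by (simp add: sum_mset_sum_list[symmetric])
  finally show ?thesis .
qed

lemma trace_eq_sum_powr:
  assumes es: "char_poly (p 1) = (\<Prod>a\<leftarrow>es. [:- a, 1:])" and t: "0 < t"
  shows "mat_trace (p t) = (\<Sum>x\<leftarrow>es. x powr t)"
proof (rule antimono_eq_if_eq_on_dyadics[where G = "\<lambda>t. mat_trace (p t)" and H = "\<lambda>t. \<Sum>x\<leftarrow>es. x powr t"])
  show "isCont (\<lambda>t. \<Sum>x\<leftarrow>es. x powr t) t"
  proof (induction es)
    case (Cons x es)
    have "isCont (\<lambda>t. x powr t) t"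
      \<comment> \<open>With base 0 the function is constantly 0, since \<open>0 powr t = 0\<close>
        for every \<open>t\<close>.\<close>
      by (cases "x = 0") (auto intro!: continuous_intros)
    with Cons show ?case by (auto intro!: continuous_intros)
  qed simp
qed (use t in \<open>auto intro: trace_antimono trace_dyadic[OF es]\<close>)

text \<open>The \<open>k\<close>-th power of an eigenvalue is at most the trace of
  \<open>p (real k)\<close>, because all eigenvalues are nonnegative. That trace stays below
  \<open>n\<close>, which an eigenvalue above 1 would eventually exceed.\<close>

lemma char_poly_roots_le_1:
  assumes es: "char_poly (p 1) = (\<Prod>a\<leftarrow>es. [:- a, 1:])" and x: "x \<in> set es"
  shows "x \<le> 1"
proof (rule ccontr)
  assume "\<not> x \<le> 1"
  then obtain k where k: "real n + 1 < x ^ k" using real_arch_pow[of x "real n + 1"] by auto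
  then have k0: "0 < k" by (cases k) auto
  have "x ^ k \<le> (\<Sum>y\<leftarrow>es. y ^ k)"
    using x char_poly_roots_nonneg[OF _ es] by (intro member_le_sum_list) auto
  also have "\<dots> = mat_trace (p 1 ^\<^sub>m k)"
    by (rule mat_trace_pow_eq[OF carrier es, symmetric]) simp
  also have "\<dots> \<le> real n"
    using trace_le[of "real k"] power[of 1 k] k0 by simp
  finally show False using k by simp
qed

text \<open>Row sums equal to 1 make the constant vector an eigenvector for eigenvalue 1. Removing
  one copy of 1 from the spectrum of \<open>p 1\<close> leaves the list \<open>xs\<close> and splits
  off the summand 1.\<close>

lemma spectral_trace:
  assumes "0 < n"
  obtains xs where "length xs = n - 1" "\<And>x. x \<in> set xs \<Longrightarrow> 0 \<le> x \<and> x \<le> 1"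
    "\<And>t. 0 < t \<Longrightarrow> mat_trace (p t) = 1 + (\<Sum>x\<leftarrow>xs. x powr t)"
proof -
  obtain es where es: "char_poly (p 1) = (\<Prod>a\<leftarrow>es. [:- a, 1:])" "length es = n"
    using char_poly_splits[of 1] by auto
  have P: "p 1 \<in> carrier_mat n n" by (simp add: carrier)
  let ?v = "vec n (\<lambda>_. 1 :: real)"
  have "p 1 *\<^sub>v ?v = 1 \<cdot>\<^sub>v ?v"
  proof (rule eq_vecI)
    fix i assume "i < dim_vec (1 \<cdot>\<^sub>v ?v)"
    then show "(p 1 *\<^sub>v ?v) $ i = (1 \<cdot>\<^sub>v ?v) $ i"
      using P row_sum[of 1 i] by (simp add: scalar_prod_def atLeast0LessThan)
  qed (use P in auto)
  moreover have "?v \<noteq> 0\<^sub>v n"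
    using assms by (auto simp: vec_eq_iff)
  ultimately have "eigenvalue (p 1) 1"
    using P unfolding eigenvalue_def eigenvector_def by (intro exI[of _ ?v]) auto
  then have "poly (char_poly (p 1)) 1 = 0"
    using eigenvalue_root_char_poly[OF P] by simp
  then have "1 \<in># proots (char_poly (p 1))"
    using prod_linear_factors_nonzero[of es] by (simp add: es(1))
  then have one: "1 \<in> set es" unfolding es(1) proots_linear_factors by simp
  show thesis
  proof (rule that[of "remove1 1 es"])
    show "length (remove1 1 es) = n - 1" using one es(2) by (simp add: length_remove1)
    show "0 \<le> x \<and> x \<le> 1" if "x \<in> set (remove1 1 es)" for x
      using char_poly_roots_nonneg[OF _ es(1)] char_poly_roots_le_1[OF es(1)] subsetD[OF set_remove1_subset that]
      by simp
    show "mat_trace (p t) = 1 + (\<Sum>x\<leftarrow>remove1 1 es. x powr t)" if "0 < t" for t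
      using trace_eq_sum_powr[OF es(1) that] sum_list_map_remove1[OF one, of "\<lambda>x. x powr t"] by simp
  qed
qed

end

subsection \<open>Sums of exponentials near integers\<close>

text \<open>Round every term to the nearer of 0 and 1; \<open>k\<close> counts the terms rounded up,
  and the errors add.\<close>

lemma sum_near_integer:
  fixes x :: "'i \<Rightarrow> real"
  assumes "finite A"
  shows "\<exists>k\<le>card A. \<bar>(\<Sum>i\<in>A. x i) - real k\<bar> \<le> (\<Sum>i\<in>A. min \<bar>x i\<bar> \<bar>1 - x i\<bar>)"
  using assms
proof (induction A rule: finite_induct)
  case (insert a A)
  then obtain k where k: "k \<le> card A" "\<bar>(\<Sum>i\<in>A. x i) - real k\<bar> \<le> (\<Sum>i\<in>A. min \<bar>x i\<bar> \<bar>1 - x i\<bar>)"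
    by blast
  show ?case
  proof (cases "\<bar>x a\<bar> \<le> \<bar>1 - x a\<bar>")
    case True
    then show ?thesis using k insert.hyps by (intro exI[of _ k]) auto
  next
    case False
    then show ?thesis using k insert.hyps by (intro exI[of _ "Suc k"]) auto
  qed
qed simp

text \<open>The right side is chosen so that, with \<open>y = l * t\<close> and after division by
  \<open>t\<close>, it is three times the exponential density of rate \<open>l\<close>. The factor 3
  comes from \<open>exp 1 \<le> 3\<close>, used for \<open>y \<le> 1\<close>.\<close>

lemma min_exp_le:
  fixes y :: real
  assumes "0 \<le> y"
  shows "min (exp (- y)) (1 - exp (- y)) \<le> 3 * y * exp (- y)"
proof (cases "y \<le> 1")
  case True
  have "1 \<le> 3 * exp (- 1 :: real)"
    using exp_le by (simp add: exp_minus field_simps)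
  also have "\<dots> \<le> 3 * exp (- y)" using True by simp
  finally have "y * 1 \<le> y * (3 * exp (- y))" using assms by (intro mult_left_mono)
  moreover have "1 - exp (- y) \<le> y" using exp_ge_add_one_self[of "- y"] by simp
  ultimately show ?thesis by (simp add: mult_ac)
next
  case False
  then have "exp (- y) \<le> 3 * y * exp (- y)" by simp
  then show ?thesis by (rule min.coboundedI1)
qed

text \<open>For \<open>0 < x < 1\<close> put \<open>x = exp (- l)\<close>: the integrand is
  dominated by three times a probability density, so the bound is the same for every rate
  \<open>l\<close>. For \<open>x = 0\<close> and \<open>x = 1\<close> the integrand
  vanishes.\<close>

lemma nn_integral_min_powr_le:
  fixes x :: real
  assumes "0 \<le> x" "x \<le> 1"
  shows "(\<integral>\<^sup>+t\<in>{0..}. ennreal (min (x powr t) (1 - x powr t) / t) \<partial>lborel) \<le> 3"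
proof (cases "0 < x \<and> x < 1")
  case False
  then have "x = 0 \<or> x = 1" using assms by auto
  then have "ennreal (min (x powr t) (1 - x powr t) / t) = 0" for t by auto
  then show ?thesis by simp
next
  case True
  define l where "l = - ln x"
  have l: "0 < l" using True by (simp add: l_def)
  have powr: "x powr t = exp (- (l * t))" for t
    using True by (simp add: powr_def l_def mult.commute)
  have "(\<integral>\<^sup>+t\<in>{0..}. ennreal (min (x powr t) (1 - x powr t) / t) \<partial>lborel)
    \<le> (\<integral>\<^sup>+t. 3 * ennreal (exponential_density l t) \<partial>lborel)"
  proof (intro nn_integral_mono)
    fix t :: real
    show "ennreal (min (x powr t) (1 - x powr t) / t) * indicator {0..} t
      \<le> 3 * ennreal (exponential_density l t)"
    proof (cases "0 < t")
      case True
      then have "min (x powr t) (1 - x powr t) / t \<le> 3 * (l * exp (- (l * t)))"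
        using min_exp_le[of "l * t"] l by (simp add: powr pos_divide_le_eq mult_ac)
      then have "ennreal (min (x powr t) (1 - x powr t) / t) \<le> ennreal 3 * ennreal (exponential_density l t)"
        using True l by (subst ennreal_mult[symmetric]) (auto simp: exponential_density_def mult.commute intro!: ennreal_leI)
      then show ?thesis using True by simp
    \<comment> \<open>At \<open>t = 0\<close> the quotient is 0 by the convention for division; for
      \<open>t < 0\<close> the indicator is 0.\<close>
    qed (auto simp: indicator_def)
  qed
  also have "\<dots> = 3 * emeasure (density lborel (exponential_density l)) UNIV"
    by (simp add: nn_integral_cmult emeasure_density)
  also have "\<dots> = 3"
    using prob_space.emeasure_space_1[OF prob_space_exponential_density[OF l]] by simp
  finally show ?thesis .
qed

text \<open>Markov's inequality: on the exceptional set the total rounding error exceeds \<delta>,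
  so \<open>1 / t\<close> is at most the sum of the errors over \<open>\<delta> * t\<close>, and
  each of the \<open>card A\<close> terms integrates to at most \<open>3 / \<delta>\<close>.
  Rounding reaches only integers up to \<open>card A\<close>, whence the bound on
  \<open>k\<close>.\<close>

lemma nn_integral_far_from_integers_le:
  fixes x :: "'i \<Rightarrow> real"
  assumes A: "finite A" and x: "\<And>i. i \<in> A \<Longrightarrow> 0 \<le> x i \<and> x i \<le> 1" and \<delta>: "0 < \<delta>"
  shows "(\<integral>\<^sup>+t\<in>{0..}. ennreal (indicator {t. \<forall>k\<le>card A. \<delta> < \<bar>(\<Sum>i\<in>A. x i powr t) - real k\<bar>} t * (1 / t)) \<partial>lborel)
    \<le> ennreal (3 / \<delta> * real (card A))"
proof -
  let ?B = "{t. \<forall>k\<le>card A. \<delta> < \<bar>(\<Sum>i\<in>A. x i powr t) - real k\<bar>}"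
  let ?m = "\<lambda>i t. min (x i powr t) (1 - x i powr t)"
  have le: "ennreal (indicator ?B t * (1 / t)) * indicator {0..} t
    \<le> (\<Sum>i\<in>A. ennreal (1 / \<delta>) * (ennreal (?m i t / t) * indicator {0..} t))" for t
  proof (cases "0 < t \<and> t \<in> ?B")
    case True
    have m: "0 \<le> ?m i t" "min \<bar>x i powr t\<bar> \<bar>1 - x i powr t\<bar> = ?m i t" if "i \<in> A" for i
      using x[OF that] True by (auto simp: powr_le1)
    obtain k where k: "k \<le> card A" "\<bar>(\<Sum>i\<in>A. x i powr t) - real k\<bar> \<le> (\<Sum>i\<in>A. min \<bar>x i powr t\<bar> \<bar>1 - x i powr t\<bar>)"
      using sum_near_integer[OF A, of "\<lambda>i. x i powr t"] by blast
    have "\<delta> < \<bar>(\<Sum>i\<in>A. x i powr t) - real k\<bar>" using True k(1) by blast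
    also note k(2)
    also have "(\<Sum>i\<in>A. min \<bar>x i powr t\<bar> \<bar>1 - x i powr t\<bar>) = (\<Sum>i\<in>A. ?m i t)"
      by (intro sum.cong refl m)
    finally have "\<delta> \<le> (\<Sum>i\<in>A. ?m i t)" by simp
    then have "1 / t \<le> (\<Sum>i\<in>A. ?m i t) / \<delta> / t"
      using True \<delta> by (intro divide_right_mono) auto
    also have "\<dots> = (\<Sum>i\<in>A. 1 / \<delta> * (?m i t / t))"
      by (simp add: sum_divide_distrib sum_distrib_left)
    finally have "ennreal (1 / t) \<le> ennreal (\<Sum>i\<in>A. 1 / \<delta> * (?m i t / t))"
      by (rule ennreal_leI)
    also have "\<dots> = (\<Sum>i\<in>A. ennreal (1 / \<delta> * (?m i t / t)))"
      using True m \<delta> by (intro sum_ennreal[symmetric] mult_nonneg_nonneg divide_nonneg_nonneg) auto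
    also have "\<dots> = (\<Sum>i\<in>A. ennreal (1 / \<delta>) * (ennreal (?m i t / t) * indicator {0..} t))"
      using True m \<delta> by (intro sum.cong refl) (simp add: ennreal_mult[symmetric])
    finally show ?thesis using True by simp
  qed (auto simp: indicator_def)
  have "(\<integral>\<^sup>+t\<in>{0..}. ennreal (indicator ?B t * (1 / t)) \<partial>lborel)
    \<le> (\<integral>\<^sup>+t. (\<Sum>i\<in>A. ennreal (1 / \<delta>) * (ennreal (?m i t / t) * indicator {0..} t)) \<partial>lborel)"
    by (intro nn_integral_mono le)
  also have "\<dots> = (\<Sum>i\<in>A. ennreal (1 / \<delta>) * (\<integral>\<^sup>+t\<in>{0..}. ennreal (?m i t / t) \<partial>lborel))"
    by (simp add: nn_integral_sum nn_integral_cmult)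
  also have "\<dots> \<le> (\<Sum>i\<in>A. ennreal (1 / \<delta>) * 3)"
    using x by (intro sum_mono mult_left_mono nn_integral_min_powr_le) auto
  also have "\<dots> = ennreal (3 / \<delta> * real (card A))"
  proof -
    have "ennreal (1 / \<delta>) * 3 = ennreal (3 / \<delta>)"
      using \<delta> ennreal_mult[of "1 / \<delta>" 3] by simp
    then have "(\<Sum>i\<in>A. ennreal (1 / \<delta>) * 3) = ennreal (3 / \<delta>) * ennreal (real (card A))"
      by (simp add: ennreal_of_nat_eq_real_of_nat mult.commute)
    also have "\<dots> = ennreal (3 / \<delta> * real (card A))"
      using \<delta> by (intro ennreal_mult[symmetric]) auto
    finally show ?thesis .
  qed
  finally show ?thesis .
qed

subsection \<open>Transition matrices of reversible chains\<close>

lemma distr_at_nonneg: "0 \<le> distr_at P a t b"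
  by (simp add: distr_at_def)

lemma
  assumes P: "markov_chain I P" and a: "a \<in> I" and t: "0 \<le> t"
  shows markov_chain_state_in: "\<omega> \<in> space (P a) \<Longrightarrow> \<omega> t \<in> I"
    and markov_chain_sets: "b \<in> I \<Longrightarrow> {\<omega> \<in> space (P a). \<omega> t = b} \<in> sets (P a)"
proof -
  have sets: "sets (P a) = sets (path_space I)" using P a by (simp add: markov_chain_def)
  have space: "space (P a) = space (path_space I)" by (rule sets_eq_imp_space_eq[OF sets])
  show "\<omega> t \<in> I" if "\<omega> \<in> space (P a)" for \<omega>
    using that t unfolding space path_space_def by (auto simp: space_restrict_space space_PiM)
  have "(\<lambda>\<omega>. \<omega> t) \<in> path_space I \<rightarrow>\<^sub>M count_space I"
    unfolding path_space_def using t
    by (intro measurable_restrict_space1 measurable_component_singleton) auto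
  then have "(\<lambda>\<omega>. \<omega> t) \<in> P a \<rightarrow>\<^sub>M count_space I"
    by (simp only: measurable_cong_sets[OF sets refl])
  from measurable_sets[OF this, of "{b}"]
  show "{\<omega> \<in> space (P a). \<omega> t = b} \<in> sets (P a)" if "b \<in> I"
    using that by (simp add: vimage_def Int_def conj_commute)
qed

lemma markov_chain_sum_distr_at:
  assumes P: "markov_chain I P" and a: "a \<in> I" and t: "0 \<le> t" and I: "finite I"
  shows "(\<Sum>b\<in>I. distr_at P a t b) = 1"
proof -
  interpret prob_space "P a" using P a by (simp add: markov_chain_def)
  have "\<P>(\<omega> in P a. True) = (\<Sum>b\<in>I. \<P>(\<omega> in P a. \<omega> t = b))"
    using markov_chain_state_in[OF P a t] markov_chain_sets[OF P a t] I
    by (intro prob_sum) (auto intro!: AE_I2)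
  then show ?thesis by (simp add: distr_at_def prob_space)
qed

text \<open>Total probability over the state at time \<open>s\<close>, with the Markov property for
  a history consisting of that one time. It is available only for states of positive probability;
  for the others both sides are 0.\<close>

lemma chapman_kolmogorov:
  assumes P: "markov_chain I P" and a: "a \<in> I" and j: "j \<in> I" and I: "finite I"
    and s: "0 \<le> s" and u: "0 \<le> u"
  shows "distr_at P a (s + u) j = (\<Sum>i\<in>I. distr_at P a s i * distr_at P i u j)"
proof -
  interpret prob_space "P a" using P a by (simp add: markov_chain_def)
  have su: "0 \<le> s + u" using s u by simp
  note ms = markov_chain_sets[OF P a s] and msu = markov_chain_sets[OF P a su]
  have mi: "{\<omega> \<in> space (P a). \<omega> (s + u) = j \<and> \<omega> s = i} \<in> sets (P a)" if "i \<in> I" for i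
    using sets.Int[OF msu[OF j] ms[OF that]] by (simp add: Int_def conj_ac cong: conj_cong)
  have "distr_at P a (s + u) j = (\<Sum>i\<in>I. \<P>(\<omega> in P a. \<omega> (s + u) = j \<and> \<omega> s = i))"
    unfolding distr_at_def using markov_chain_state_in[OF P a s] mi msu[OF j] I
    by (intro prob_sum) (auto intro!: AE_I2)
  also have "\<dots> = (\<Sum>i\<in>I. distr_at P a s i * distr_at P i u j)"
  proof (intro sum.cong refl)
    fix i assume i: "i \<in> I"
    let ?Q = "\<P>(\<omega> in P a. \<omega> s = i)"
    show "\<P>(\<omega> in P a. \<omega> (s + u) = j \<and> \<omega> s = i) = distr_at P a s i * distr_at P i u j"
    proof (cases "?Q = 0")
      case True
      have "\<P>(\<omega> in P a. \<omega> (s + u) = j \<and> \<omega> s = i) \<le> ?Q"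
        by (intro finite_measure_mono ms i) auto
      then have "\<P>(\<omega> in P a. \<omega> (s + u) = j \<and> \<omega> s = i) = 0"
        unfolding True measure_le_0_iff .
      then show ?thesis using True by (simp add: distr_at_def)
    next
      case False
      then have Q: "0 < ?Q" by (simp add: zero_less_measure_iff)
      \<comment> \<open>The history has last index 0, so constant functions serve for its times and
        states.\<close>
      have "\<P>(\<omega> in P a. \<omega> ((\<lambda>_. s) (0::nat) + u) = j \<bar> \<forall>l\<le>(0::nat). \<omega> ((\<lambda>_. s) l) = (\<lambda>_. i) l)
        = distr_at P ((\<lambda>_. i) (0::nat)) u j"
        using P[unfolded markov_chain_def, THEN conjunct2, rule_format, OF a j, of "\<lambda>_. s" 0 "\<lambda>_. i" u] s u i Q
        by simp
      then have "\<P>(\<omega> in P a. \<omega> (s + u) = j \<bar> \<omega> s = i) = distr_at P i u j" by simp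
      then show ?thesis using Q by (simp add: cond_prob_def distr_at_def field_simps)
    qed
  qed
  finally show ?thesis .
qed

text \<open>On expanding the squares, the two pure terms give \<open>2 * real (card I)\<close> times
  the sum of all squared entries. In the cross term the sum over \<open>b\<close> is a column sum,
  equal to 1 by symmetry, so the whole of it is \<open>2 * real (card I)\<close>.\<close>

lemma sum_sq_diff_stochastic:
  fixes q :: "'a \<Rightarrow> 'a \<Rightarrow> real"
  assumes I: "finite I" and sym: "\<And>a b. a \<in> I \<Longrightarrow> b \<in> I \<Longrightarrow> q a b = q b a"
    and row: "\<And>a. a \<in> I \<Longrightarrow> (\<Sum>b\<in>I. q a b) = 1"
  shows "(\<Sum>(a, b)\<in>I \<times> I. \<Sum>i\<in>I. (q a i - q b i)\<^sup>2)
    = 2 * real (card I) * ((\<Sum>a\<in>I. \<Sum>i\<in>I. (q a i)\<^sup>2) - 1)"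
proof -
  let ?S = "\<Sum>a\<in>I. \<Sum>i\<in>I. (q a i)\<^sup>2"
  have col: "(\<Sum>b\<in>I. q b i) = 1" if "i \<in> I" for i
    using row[OF that] that by (simp add: sym cong: sum.cong)
  have "(\<Sum>(a, b)\<in>I \<times> I. \<Sum>i\<in>I. (q a i - q b i)\<^sup>2)
    = (\<Sum>a\<in>I. \<Sum>b\<in>I. (\<Sum>i\<in>I. (q a i)\<^sup>2) + (\<Sum>i\<in>I. (q b i)\<^sup>2) - 2 * (\<Sum>i\<in>I. q a i * q b i))"
    by (simp add: sum.cartesian_product[symmetric] power2_diff sum.distrib sum_subtractf
        sum_distrib_left mult.assoc)
  also have "\<dots> = 2 * real (card I) * ?S - 2 * (\<Sum>a\<in>I. \<Sum>b\<in>I. \<Sum>i\<in>I. q a i * q b i)"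
    by (simp add: sum.distrib sum_subtractf sum_distrib_left[symmetric])
  also have "(\<Sum>a\<in>I. \<Sum>b\<in>I. \<Sum>i\<in>I. q a i * q b i) = (\<Sum>a\<in>I. \<Sum>i\<in>I. q a i * (\<Sum>b\<in>I. q b i))"
    unfolding sum_distrib_left by (intro sum.cong refl sum.swap)
  also have "\<dots> = real (card I)"
    by (simp add: col row cong: sum.cong)
  finally show ?thesis by (simp add: algebra_simps)
qed

lemma reversible_uniform_imp_symmetric:
  assumes "reversible_wrt {1..n} (pmf_of_set {1..n}) P" "0 \<le> t" "a \<in> {1..n}" "b \<in> {1..n}"
  shows "distr_at P a t b = distr_at P b t a"
proof -
  have "pmf (pmf_of_set {1..n}) c = 1 / real n" if "c \<in> {1..n}" for c
    using that by (subst pmf_of_set) (auto simp: indicator_def)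
  moreover have "pmf (pmf_of_set {1..n}) a * distr_at P a t b = pmf (pmf_of_set {1..n}) b * distr_at P b t a"
    using assms by (auto simp: reversible_wrt_def)
  ultimately show ?thesis using assms(3,4) by simp
qed

text \<open>
  The \<open>x i\<close> are \<open>exp (- 2 * \<lambda>)\<close> for the eigenvalues \<open>\<lambda>\<close> of minus the generator, with one zero
  eigenvalue left out.
\<close>

lemma mean_l2_dist_eq_sum_powr:
  assumes n: "0 < n" and P: "markov_chain {1..n} P"
    and rev: "reversible_wrt {1..n} (pmf_of_set {1..n}) P"
  obtains x :: "nat \<Rightarrow> real" where "\<And>i. i < n - 1 \<Longrightarrow> 0 \<le> x i \<and> x i \<le> 1"
    "\<And>t. 0 < t \<Longrightarrow> mean_l2_dist n P t = 2 / real n * (\<Sum>i<n - 1. x i powr t)"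
proof -
  \<comment> \<open>Matrix indices start at 0 and states at 1, hence the shift by
    \<open>Suc\<close>.\<close>
  define p where "p t = mat n n (\<lambda>(i, j). distr_at P (Suc i) t (Suc j))" for t
  note distr_sym = reversible_uniform_imp_symmetric[OF rev]
  note row = markov_chain_sum_distr_at[OF P _ _ finite_atLeastAtMost]
  interpret symmetric_markov_semigroup n p
  proof
    show "p t \<in> carrier_mat n n" for t by (simp add: p_def)
    show "p t $$ (i, j) = p t $$ (j, i)" if "0 \<le> t" "i < n" "j < n" for t i j
      using that distr_sym[of t "Suc i" "Suc j"] by (simp add: p_def)
    show "0 \<le> p t $$ (i, j)" if "i < n" "j < n" for t i j
      using that by (simp add: p_def distr_at_nonneg)
    show "(\<Sum>j<n. p t $$ (i, j)) = 1" if "0 \<le> t" "i < n" for t i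
      using row[of "Suc i" t] that by (simp add: p_def sum.atLeast1_atMost_eq)
    show "p (s + t) = p s * p t" if "0 \<le> s" "0 \<le> t" for s t
    proof (rule eq_matI)
      fix i j assume "i < dim_row (p s * p t)" "j < dim_col (p s * p t)"
      then have "i < n" "j < n" by (simp_all add: p_def)
      then show "p (s + t) $$ (i, j) = (p s * p t) $$ (i, j)"
        using chapman_kolmogorov[OF P, of "Suc i" "Suc j" s t] that
        by (simp add: p_def sum.atLeast1_atMost_eq scalar_prod_def atLeast0LessThan)
    qed (simp_all add: p_def)
  qed
  obtain xs where xs: "length xs = n - 1" "\<And>x. x \<in> set xs \<Longrightarrow> 0 \<le> x \<and> x \<le> 1"
    "\<And>t. 0 < t \<Longrightarrow> mat_trace (p t) = 1 + (\<Sum>x\<leftarrow>xs. x powr t)"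
    using spectral_trace[OF n] by blast
  show thesis
  \<comment> \<open>The mean distance at \<open>t\<close> involves the trace at
    \<open>t + t\<close>; squaring the eigenvalues of \<open>p 1\<close> absorbs the
    doubling.\<close>
  proof (rule that[of "\<lambda>i. (xs ! i) powr 2"])
    show "0 \<le> (xs ! i) powr 2 \<and> (xs ! i) powr 2 \<le> 1" if "i < n - 1" for i
      using xs(1) xs(2)[of "xs ! i"] that by (auto simp: power_le_one)
    fix t :: real assume t: "0 < t"
    have "(\<Sum>(a, b)\<in>{1..n} \<times> {1..n}. \<Sum>i\<in>{1..n}. (distr_at P a t i - distr_at P b t i)\<^sup>2)
      = 2 * real (card {1..n}) * ((\<Sum>a\<in>{1..n}. \<Sum>i\<in>{1..n}. (distr_at P a t i)\<^sup>2) - 1)"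
      using t by (intro sum_sq_diff_stochastic distr_sym row) auto
    also have "(\<Sum>a\<in>{1..n}. \<Sum>i\<in>{1..n}. (distr_at P a t i)\<^sup>2) = mat_trace (p (t + t))"
      using t by (simp only: trace_double less_imp_le) (simp add: sum.atLeast1_atMost_eq p_def)
    also have "\<dots> - 1 = (\<Sum>x\<leftarrow>xs. x powr (t + t))"
      using xs(3)[of "t + t"] t by simp
    also have "\<dots> = (\<Sum>i<n - 1. (xs ! i) powr (t + t))"
      using xs(1) by (simp add: sum_list_sum_nth atLeast0LessThan)
    also have "\<dots> = (\<Sum>i<n - 1. ((xs ! i) powr 2) powr t)"
      by (simp add: powr_powr)
    finally show "mean_l2_dist n P t = 2 / real n * (\<Sum>i<n - 1. ((xs ! i) powr 2) powr t)"
      by (simp add: mean_l2_dist_def l2_norm_sq_def power2_eq_square)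
  qed
qed

section \<open>From distances to integers to the neighbourhood of \<open>A_L n\<close>\<close>

theorem theorem6:
  fixes \<delta> :: real
  assumes "0 < \<delta>" and "\<delta> < 1 / 2"
  shows "\<exists>K::real. K > 0 \<and>
    (\<forall>(n::nat) (P :: nat \<Rightarrow> (real \<Rightarrow> nat) measure).
       n \<ge> 2 \<and> markov_chain {1..n} P \<and> irreducible_chain {1..n} P \<and>
       reversible_wrt {1..n} (pmf_of_set {1..n}) P \<longrightarrow>
       (\<integral>\<^sup>+ t\<in>{0..}. ennreal (indicator {t. t \<ge> 0 \<and> mean_l2_dist n P t \<notin> A_L_nbhd n \<delta>} t * (1 / t)) \<partial>lborel)
         \<le> ennreal (K * real n))"
proof (intro exI[of _ "3 / \<delta>"] conjI allI impI)
  show "3 / \<delta> > 0" using assms by simp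
  fix n :: nat and P :: "nat \<Rightarrow> (real \<Rightarrow> nat) measure"
  assume asm: "n \<ge> 2 \<and> markov_chain {1..n} P \<and> irreducible_chain {1..n} P \<and>
       reversible_wrt {1..n} (pmf_of_set {1..n}) P"
  then have n: "2 \<le> n" by simp
  obtain x where x: "\<And>i. i < n - 1 \<Longrightarrow> 0 \<le> x i \<and> x i \<le> 1"
    and mean: "\<And>t. 0 < t \<Longrightarrow> mean_l2_dist n P t = 2 / real n * (\<Sum>i<n - 1. x i powr t)"
    using mean_l2_dist_eq_sum_powr[of n P] asm by auto
  \<comment> \<open>Scaling by \<open>2 / real n\<close> turns distance \<delta> from
    \<open>k\<close> into distance \<open>2 * \<delta> / real n\<close> from a point of
    \<open>A_L n\<close>, as \<open>k \<le> n - 1\<close> means \<open>k < n\<close>. The range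
    condition in \<open>A_L_nbhd\<close> holds because the sum has \<open>n - 1\<close> terms
    between 0 and 1.\<close>
  have near: "mean_l2_dist n P t \<in> A_L_nbhd n \<delta>"
    if t: "0 < t" and k: "k \<le> n - 1" "\<bar>(\<Sum>i<n - 1. x i powr t) - real k\<bar> \<le> \<delta>" for t k
  proof -
    let ?F = "\<Sum>i<n - 1. x i powr t"
    have "?F \<le> (\<Sum>i<n - 1. 1)"
      using x t by (intro sum_mono powr_le1) auto
    then have F: "0 \<le> ?F" "?F \<le> real n - 1" using n by (auto intro: sum_nonneg)
    have "2 / real n * ?F \<le> 2 / real n * (real n - 1)"
      using F by (intro mult_left_mono) auto
    moreover have "dist (2 / real n * ?F) (2 * real k / real n) \<le> 2 * \<delta> / real n"
    proof -
      have "2 / real n * ?F - 2 * real k / real n = 2 / real n * (?F - real k)"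
        by (simp only: right_diff_distrib times_divide_eq_left)
      then have "dist (2 / real n * ?F) (2 * real k / real n) = \<bar>2 / real n * (?F - real k)\<bar>"
        by (simp only: dist_real_def)
      also have "\<dots> = 2 / real n * \<bar>?F - real k\<bar>" by (subst abs_mult) simp
      also have "\<dots> \<le> 2 / real n * \<delta>" using k(2) by (intro mult_left_mono) auto
      finally show ?thesis by simp
    qed
    moreover have "2 * real k / real n \<in> A_L n"
      using k(1) n by (auto simp: A_L_def)
    ultimately show ?thesis using F by (auto simp: A_L_nbhd_def mean[OF t])
  qed
  let ?B = "{t. \<forall>k\<le>card {..<n - 1}. \<delta> < \<bar>(\<Sum>i<n - 1. x i powr t) - real k\<bar>}"
  have "(\<integral>\<^sup>+ t\<in>{0..}. ennreal (indicator {t. t \<ge> 0 \<and> mean_l2_dist n P t \<notin> A_L_nbhd n \<delta>} t * (1 / t)) \<partial>lborel)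
    \<le> (\<integral>\<^sup>+ t\<in>{0..}. ennreal (indicator ?B t * (1 / t)) \<partial>lborel)"
  \<comment> \<open>The exceptional sets are compared pointwise; monotonicity of the nonnegative
    integral asks for no measurability.\<close>
  proof (intro nn_integral_mono)
    fix t :: real
    show "ennreal (indicator {t. t \<ge> 0 \<and> mean_l2_dist n P t \<notin> A_L_nbhd n \<delta>} t * (1 / t)) * indicator {0..} t
      \<le> ennreal (indicator ?B t * (1 / t)) * indicator {0..} t"
    proof (cases "0 < t")
      case True
      then have "t \<in> ?B" if "mean_l2_dist n P t \<notin> A_L_nbhd n \<delta>"
        unfolding mem_Collect_eq card_lessThan using near that by (meson not_le)
      then show ?thesis by (auto simp: indicator_def)
    next
      case False
      \<comment> \<open>The formula for the mean distance covers only positive times; at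
        \<open>t = 0\<close> the weight \<open>1 / t\<close> is 0.\<close>
      then have "t < 0 \<or> t = 0" by auto
      then show ?thesis by auto
    qed
  qed
  also have "\<dots> \<le> ennreal (3 / \<delta> * real (card {..<n - 1}))"
    using x assms by (intro nn_integral_far_from_integers_le) auto
  also have "\<dots> \<le> ennreal (3 / \<delta> * real n)"
    using assms by (intro ennreal_leI mult_left_mono) auto
  finally show "(\<integral>\<^sup>+ t\<in>{0..}. ennreal (indicator {t. t \<ge> 0 \<and> mean_l2_dist n P t \<notin> A_L_nbhd n \<delta>} t * (1 / t)) \<partial>lborel)
    \<le> ennreal (3 / \<delta> * real n)" .
qed

end
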